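(* Let $m,n$ be positive integers (with $n\ge 3$ for the EQ grid), let $f$ be a continuous complex-valued function on the unit sphere, written in spherical coordinates as $f(\phi,\theta)=f(\cos\phi\sin\theta,\sin\phi\sin\theta,\cos\theta)$, and let $f_{j,k}=f(\phi_k,\theta_j)$, $j=0,\dots,n-1$, $k=0,\dots,2m-1$, be its samples on the EQ, SEQ, or GL grid. Let $s:[0,2\pi]\times[0,\pi]\to\mathbb{C}$ be the spherical barycentric interpolant of these data for that grid (all defined in the context). Then $s$ is a BMC function, i.e. its DFS extension $\tilde s:[0,2\pi]\times[-\pi,\pi]\to\mathbb{C}$ is a BMC function with $a=b=\pi$. Furthermore, in the case of the EQ grid, $s$ is a BMC-I function, i.e. $\tilde s$ is a BMC-I function.
   Context: Grids. For $k=0,\dots,2m-1$ and $j=0,\dots,n-1$: EQ: $(\phi_k,\theta_j)=\left(\frac{\pi}{m}k,\frac{\pi}{n-1}j\right)$; SEQ: $(\phi_k,\theta_j)=\left(\frac{\pi}{m}(k+\frac12),\frac{\pi}{n}(j+\frac12)\right)$; GL: $(\phi_k,\theta_j)=\left(\frac{\pi}{m}k,\arccos(z_j)\right)$, where $z_0>\dots>z_{n-1}$ are the roots of the degree $n$ Legendre polynomial. Split data. For $j=0,\dots,n-1$, $k=0,\dots,m-1$: $f^-_{j,k}=\frac12(f_{j,k}-f_{j,k+m})$ and $f^+_{j,k}=\frac12(f_{j,k}+f_{j,k+m})$. Latitude interpolants $u^{\rm c}_k(\theta)$, $u^{\rm s}_k(\theta)$, $k=0,\dots,m-1$. Here (and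 for $s$ below) the value of any barycentric formula at a point where terms are singular is understood as the limiting value (removable singularity). All sums are over $j=0,\dots,n-1$. EQ: with $\delta_0=\delta_{n-1}=\frac12$ and $\delta_j=1$ otherwise, $$u^{\rm c}_k(\theta)=\frac{\sum_{j}\frac{(-1)^j\delta_j}{\cos\theta-\cos\theta_j}f^+_{j,k}}{\sum_{j}\frac{(-1)^j\delta_j}{\cos\theta-\cos\theta_j}},\qquad u^{\rm s}_k(\theta)=\sin\theta\,\frac{\sum_{j}\frac{(-1)^j\sin\theta_j}{\cos\theta-\cos\theta_j}f^-_{j,k}}{\sum_{j}\frac{(-1)^j\sin^2\theta_j}{\cos\theta-\cos\theta_j}}.$$ SEQ: $$u^{\rm c}_k(\theta)=\frac{\sum_{j}\frac{(-1)^j\sin\theta_j}{\cos\theta-\cos\theta_j}f^+_{j,k}}{\sum_{j}\frac{(-1)^j\sin\theta_j}{\cos\theta-\cos\theta_j}},\qquad u^{\rm s}_k(\theta)=\sin\theta\,\frac{\sum_{j}\frac{(-1)^j}{\cos\theta-\cos\theta_j}f^-_{j,k}}{\sum_{j}\frac{(-1)^j\sin\theta_j}{\cos\theta-\cos\theta_j}}.$$ GL: with $w_j=\left(\prod_{i=0,\,i\ne j}^{n-1}(\cos\theta_j-\cos\theta_i)\right)^{-1}$, $$u^{\rm c}_k(\theta)=\frac{\sum_{j}\frac{w_j}{\cos\theta-\cos\theta_j}f^+_{j,k}}{\sum_{j}\frac{w_j}{\cos\theta-\cos\theta_j}},\qquad u^{\rm s}_k(\theta)=\sin\theta\,\frac{\sum_{j}\frac{w_j\csc\theta_j}{\cos\theta-\cos\theta_j}f^-_{j,k}}{\sum_{j}\frac{w_j}{\cos\theta-\cos\theta_j}}.$$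 Spherical barycentric interpolant: $$s(\phi,\theta)=\begin{cases}\dfrac{\sum_{k=0}^{m-1}(-1)^k\left[\cot(\phi-\phi_k)\,u^{\rm c}_k(\theta)+\csc(\phi-\phi_k)\,u^{\rm s}_k(\theta)\right]}{\sum_{k=0}^{m-1}(-1)^k\cot(\phi-\phi_k)}, & m\text{ even},\\[3ex] \dfrac{\sum_{k=0}^{m-1}(-1)^k\left[\csc(\phi-\phi_k)\,u^{\rm c}_k(\theta)+\cot(\phi-\phi_k)\,u^{\rm s}_k(\theta)\right]}{\sum_{k=0}^{m-1}(-1)^k\csc(\phi-\phi_k)}, & m\text{ odd}.\end{cases}$$ DFS (double Fourier sphere) extension. For $s:[0,2\pi]\times[0,\pi]\to\mathbb{C}$, put $g(\phi,\theta)=s(\phi,\theta)$ and $h(\phi,\theta)=s(\phi+\pi,\theta)$ on $[0,\pi]\times[0,\pi]$; then $\tilde s$ on $[0,2\pi]\times[-\pi,\pi]$ equals $g(\phi,\theta)$ on $[0,\pi]\times[0,\pi]$, $h(\phi-\pi,\theta)$ on $[\pi,2\pi]\times[0,\pi]$, $g(\phi-\pi,-\theta)$ on $[\pi,2\pi]\times[-\pi,0]$, and $h(\phi,-\theta)$ on $[0,\pi]\times[-\pi,0]$ (that these agree on overlaps is part of the assertion). BMC functions. Let $a,b>0$. A function $F:[0,2a]\times[-b,b]\to\mathbb{C}$ is a block-mirror-centrosymmetric (BMC) function if it is $2a$-periodic in its first variable (i.e. $F(0,y)=F(2a,y)$ for all $y$) and there are functions $g,h:[0,a]\times[0,b]\to\mathbb{C}$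 such that $F(x,y)=g(x,y)$ on $[0,a]\times[0,b]$, $F(x,y)=h(x-a,y)$ on $[a,2a]\times[0,b]$, $F(x,y)=h(x,-y)$ on $[0,a]\times[-b,0]$, and $F(x,y)=g(x-a,-y)$ on $[a,2a]\times[-b,0]$. A BMC function $F$ is a BMC-I function if in addition it is $2b$-periodic in its second variable (i.e. $F(x,-b)=F(x,b)$ for all $x$) and each of $F(\cdot,0)$ and $F(\cdot,b)$ is constant. *)

theory Defs
  imports "HOL-Analysis.Analysis" "HOL-Computational_Algebra.Polynomial"
begin

datatype grid = EQ | SEQ | GL

definition csc :: "real \<Rightarrow> real" where
  "csc x = 1 / sin x"

text \<open>Legendre polynomial of degree \<open>n\<close>, by Rodrigues' formula
  \<open>P\<^sub>n = 1 / (2^n n!) (d/dx)^n (x^2 - 1)^n\<close>.\<close>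

definition legendre :: "nat \<Rightarrow> real poly" where
  "legendre n = smult (1 / (2 ^ n * fact n)) ((pderiv ^^ n) ([:-1, 0, 1:] ^ n))"

text \<open>Indices start at 0, so the decreasing list of the \<open>n\<close> real roots is
  \<open>z\<^sub>0 > \<dots> > z\<^bsub>n-1\<^esub>\<close>.\<close>

definition legendre_root :: "nat \<Rightarrow> nat \<Rightarrow> real" where
  "legendre_root n j = rev (sorted_list_of_set {x. poly (legendre n) x = 0}) ! j"

fun grid_phi :: "grid \<Rightarrow> nat \<Rightarrow> nat \<Rightarrow> real" where
  "grid_phi EQ m k = pi / real m * real k"
| "grid_phi SEQ m k = pi / real m * (real k + 1 / 2)"
| "grid_phi GL m k = pi / real m * real k"

fun grid_theta :: "grid \<Rightarrow> nat \<Rightarrow> nat \<Rightarrow> real" where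
  "grid_theta EQ n j = pi / (real n - 1) * real j"
| "grid_theta SEQ n j = pi / real n * (real j + 1 / 2)"
| "grid_theta GL n j = arccos (legendre_root n j)"

definition sph_point :: "real \<Rightarrow> real \<Rightarrow> real ^ 3" where
  "sph_point \<phi> \<theta> = vector [cos \<phi> * sin \<theta>, sin \<phi> * sin \<theta>, cos \<theta>]"

definition samples :: "grid \<Rightarrow> nat \<Rightarrow> nat \<Rightarrow> (real ^ 3 \<Rightarrow> complex) \<Rightarrow> nat \<Rightarrow> nat \<Rightarrow> complex" where
  "samples G m n f j k = f (sph_point (grid_phi G m k) (grid_theta G n j))"

definition data_plus :: "nat \<Rightarrow> (nat \<Rightarrow> nat \<Rightarrow> complex) \<Rightarrow> nat \<Rightarrow> nat \<Rightarrow> complex" where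
  "data_plus m d j k = (d j k + d j (k + m)) / 2"

definition data_minus :: "nat \<Rightarrow> (nat \<Rightarrow> nat \<Rightarrow> complex) \<Rightarrow> nat \<Rightarrow> nat \<Rightarrow> complex" where
  "data_minus m d j k = (d j k - d j (k + m)) / 2"

definition gl_weight :: "nat \<Rightarrow> nat \<Rightarrow> real" where
  "gl_weight n j =
     inverse (\<Prod>i \<in> {..<n} - {j}. cos (grid_theta GL n j) - cos (grid_theta GL n i))"

text \<open>\<open>uc_weight\<close> is used in both numerator and denominator of \<open>u\<^sup>c\<close>;
  \<open>us_num_weight\<close> and \<open>us_den_weight\<close> are those of \<open>u\<^sup>s\<close>.\<close>

fun uc_weight :: "grid \<Rightarrow> nat \<Rightarrow> nat \<Rightarrow> real" where
  "uc_weight EQ n j = (- 1) ^ j * (if j = 0 \<or> j = n - 1 then 1 / 2 else 1)"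
| "uc_weight SEQ n j = (- 1) ^ j * sin (grid_theta SEQ n j)"
| "uc_weight GL n j = gl_weight n j"

fun us_num_weight :: "grid \<Rightarrow> nat \<Rightarrow> nat \<Rightarrow> real" where
  "us_num_weight EQ n j = (- 1) ^ j * sin (grid_theta EQ n j)"
| "us_num_weight SEQ n j = (- 1) ^ j"
| "us_num_weight GL n j = gl_weight n j * csc (grid_theta GL n j)"

fun us_den_weight :: "grid \<Rightarrow> nat \<Rightarrow> nat \<Rightarrow> real" where
  "us_den_weight EQ n j = (- 1) ^ j * (sin (grid_theta EQ n j))\<^sup>2"
| "us_den_weight SEQ n j = (- 1) ^ j * sin (grid_theta SEQ n j)"
| "us_den_weight GL n j = gl_weight n j"

text \<open>\<open>bary_sum G n w v \<theta>\<close> is the sum of \<open>w\<^sub>j v\<^sub>j / (cos \<theta> - cos \<theta>\<^sub>j)\<close> over \<open>j < n\<close>.\<close>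

definition bary_sum ::
  "grid \<Rightarrow> nat \<Rightarrow> (nat \<Rightarrow> real) \<Rightarrow> (nat \<Rightarrow> complex) \<Rightarrow> real \<Rightarrow> complex" where
  "bary_sum G n w v \<theta> =
     (\<Sum>j<n. complex_of_real (w j / (cos \<theta> - cos (grid_theta G n j))) * v j)"

text \<open>The function \<open>F\<close> with its values on the singular set \<open>S\<close> replaced by limits. Without this,
  division by zero would silently drop the singular terms. The formulas below make sense for all
  real arguments, so the limits are two-sided also at the end points of the domain.\<close>

definition remove_sings :: "real set \<Rightarrow> (real \<Rightarrow> complex) \<Rightarrow> real \<Rightarrow> complex" where
  "remove_sings S F x = (if x \<in> S then Lim (at x) F else F x)"

definition theta_sings :: "grid \<Rightarrow> nat \<Rightarrow> real set" where
  "theta_sings G n = {\<theta>. \<exists>j<n. cos \<theta> = cos (grid_theta G n j)}"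

definition phi_sings :: "grid \<Rightarrow> nat \<Rightarrow> real set" where
  "phi_sings G m = {\<phi>. \<exists>k<m. sin (\<phi> - grid_phi G m k) = 0}"

definition uc :: "grid \<Rightarrow> nat \<Rightarrow> nat \<Rightarrow> (nat \<Rightarrow> nat \<Rightarrow> complex) \<Rightarrow> nat \<Rightarrow> real \<Rightarrow> complex" where
  "uc G m n d k = remove_sings (theta_sings G n)
     (\<lambda>\<theta>. bary_sum G n (uc_weight G n) (\<lambda>j. data_plus m d j k) \<theta>
          / bary_sum G n (uc_weight G n) (\<lambda>_. 1) \<theta>)"

definition us :: "grid \<Rightarrow> nat \<Rightarrow> nat \<Rightarrow> (nat \<Rightarrow> nat \<Rightarrow> complex) \<Rightarrow> nat \<Rightarrow> real \<Rightarrow> complex" where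
  "us G m n d k = remove_sings (theta_sings G n)
     (\<lambda>\<theta>. complex_of_real (sin \<theta>)
          * (bary_sum G n (us_num_weight G n) (\<lambda>j. data_minus m d j k) \<theta>
             / bary_sum G n (us_den_weight G n) (\<lambda>_. 1) \<theta>))"

definition sph_interpolant ::
  "grid \<Rightarrow> nat \<Rightarrow> nat \<Rightarrow> (nat \<Rightarrow> nat \<Rightarrow> complex) \<Rightarrow> real \<Rightarrow> real \<Rightarrow> complex" where
  "sph_interpolant G m n d \<phi> \<theta> = remove_sings (phi_sings G m)
     (\<lambda>\<phi>. let C = (\<lambda>k. complex_of_real (cot (\<phi> - grid_phi G m k)));
              D = (\<lambda>k. complex_of_real (csc (\<phi> - grid_phi G m k)))
          in if even m
             then (\<Sum>k<m. (- 1) ^ k * (C k * uc G m n d k \<theta> + D k * us G m n d k \<theta>))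
                  / (\<Sum>k<m. (- 1) ^ k * C k)
             else (\<Sum>k<m. (- 1) ^ k * (D k * uc G m n d k \<theta> + C k * us G m n d k \<theta>))
                  / (\<Sum>k<m. (- 1) ^ k * D k)) \<phi>"

text \<open>A function on a rectangle is modelled by a total function whose values outside the rectangle
  are irrelevant. \<open>is_dfs_extension s F\<close> imposes the defining equations on all four closed blocks;
  hence \<open>F\<close> is determined on \<open>[0,2\<pi>] \<times> [-\<pi>,\<pi>]\<close>, and it exists iff the equations agree on the
  overlaps.\<close>

definition is_dfs_extension ::
  "(real \<Rightarrow> real \<Rightarrow> complex) \<Rightarrow> (real \<Rightarrow> real \<Rightarrow> complex) \<Rightarrow> bool" where
  "is_dfs_extension s F \<longleftrightarrow>
     (let g = (\<lambda>\<phi> \<theta>. s \<phi> \<theta>); h = (\<lambda>\<phi> \<theta>. s (\<phi> + pi) \<theta>) in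
       (\<forall>\<phi>\<in>{0..pi}. \<forall>\<theta>\<in>{0..pi}. F \<phi> \<theta> = g \<phi> \<theta>) \<and>
       (\<forall>\<phi>\<in>{pi..2*pi}. \<forall>\<theta>\<in>{0..pi}. F \<phi> \<theta> = h (\<phi> - pi) \<theta>) \<and>
       (\<forall>\<phi>\<in>{pi..2*pi}. \<forall>\<theta>\<in>{-pi..0}. F \<phi> \<theta> = g (\<phi> - pi) (- \<theta>)) \<and>
       (\<forall>\<phi>\<in>{0..pi}. \<forall>\<theta>\<in>{-pi..0}. F \<phi> \<theta> = h \<phi> (- \<theta>)))"

definition is_BMC :: "real \<Rightarrow> real \<Rightarrow> (real \<Rightarrow> real \<Rightarrow> complex) \<Rightarrow> bool" where
  "is_BMC a b F \<longleftrightarrow>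
     (\<forall>y\<in>{-b..b}. F 0 y = F (2 * a) y) \<and>
     (\<exists>g h.
       (\<forall>x\<in>{0..a}. \<forall>y\<in>{0..b}. F x y = g x y) \<and>
       (\<forall>x\<in>{a..2*a}. \<forall>y\<in>{0..b}. F x y = h (x - a) y) \<and>
       (\<forall>x\<in>{0..a}. \<forall>y\<in>{-b..0}. F x y = h x (- y)) \<and>
       (\<forall>x\<in>{a..2*a}. \<forall>y\<in>{-b..0}. F x y = g (x - a) (- y)))"

definition is_BMC_I :: "real \<Rightarrow> real \<Rightarrow> (real \<Rightarrow> real \<Rightarrow> complex) \<Rightarrow> bool" where
  "is_BMC_I a b F \<longleftrightarrow>
     is_BMC a b F \<and>
     (\<forall>x\<in>{0..2*a}. F x (- b) = F x b) \<and>
     (\<lambda>x. F x 0) constant_on {0..2*a} \<and>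
     (\<lambda>x. F x b) constant_on {0..2*a}"

end

theory Submission
  imports Defs
begin

text \<open>The quotients defining \<open>s\<close> are \<open>2\<pi>\<close>-periodic in \<open>\<phi>\<close>, and the parts built from \<open>u\<^sup>c\<close> alone
  are even \<open>\<pi>\<close>-periodic. So everything hinges on \<open>u\<^sup>s = 0\<close> at the poles, where the factor
  \<open>sin \<theta>\<close> vanishes: on the SEQ and GL grids no node is a pole (for GL because all \<open>n\<close> roots of the
  Legendre polynomial lie in the open interval, by Rolle), and on the EQ grid the singular terms have
  weight zero and the remaining denominator is \<open>\<plusminus>1\<close> there. On the EQ grid moreover \<open>u\<^sup>c\<close> at a pole is
  the common sample value \<open>c\<close>, so \<open>s\<close> reduces to \<open>c\<close> times a quotient of equal sums, which are
  nonzero.\<close>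

section \<open>Zeros of Legendre polynomials\<close>

text \<open>Rolle's theorem in each gap between consecutive elements of \<open>A\<close>. Elements
  are added in increasing order. The bounds by \<open>Min\<close> and \<open>Max\<close> strengthen
  the induction: each new root lies above the old maximum, hence above all roots found so far, so it
  is distinct from them.\<close>

lemma pderiv_roots_between:
  fixes p :: "real poly"
  assumes "finite A" "A \<noteq> {}" "\<forall>x\<in>A. poly p x = 0"
  shows "\<exists>B. finite B \<and> Suc (card B) = card A \<and>
    (\<forall>x\<in>B. poly (pderiv p) x = 0 \<and> Min A < x \<and> x < Max A)"
  using assms
proof (induction A rule: finite_linorder_max_induct)
  case empty
  then show ?case by simp
next
  case (insert b A)
  show ?case
  proof (cases "A = {}")
    case True
    then show ?thesis by (intro exI[of _ "{}"]) simp
  next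
    case False
    from insert.IH[OF False] insert.prems obtain B where B: "finite B" "Suc (card B) = card A"
      "\<forall>x\<in>B. poly (pderiv p) x = 0 \<and> Min A < x \<and> x < Max A"
      by auto
    have max: "Max A \<in> A" using insert.hyps False by simp
    then have lt: "Max A < b" using insert.hyps by blast
    have "poly p (Max A) = poly p b" using max insert.prems by simp
    then have "\<exists>z>Max A. z < b \<and> DERIV (poly p) z :> 0"
      using lt by (intro Rolle) (auto simp: real_differentiable_def intro: poly_DERIV continuous_intros)
    then obtain z where z: "Max A < z" "z < b" "DERIV (poly p) z :> 0" by blast
    then have "poly (pderiv p) z = 0" using poly_DERIV DERIV_unique by blast
    moreover have "z \<notin> B" using B z by force
    moreover have "Min A \<le> Max A" using insert.hyps False by simp
    moreover have "Max (insert b A) = b"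
      using insert.hyps by (intro Max_eqI) (auto simp: less_imp_le)
    moreover have "Min (insert b A) = Min A"
      using insert.hyps False lt \<open>Min A \<le> Max A\<close>
      by (simp add: min_absorb2 del: Min_le_iff Min_ge_iff)
    moreover have "b \<notin> A" using insert.hyps by blast
    ultimately show ?thesis using B z lt insert.hyps
      by (intro exI[of _ "insert z B"]) force
  qed
qed

text \<open>By the product rule, each differentiation costs at most one factor \<open>q\<close>.
  With \<open>q\<close> = x^2 - 1 this keeps -1 and 1 as roots of all derivatives of order below
  \<open>n\<close>.\<close>

lemma higher_pderiv_power_dvd:
  fixes q :: "real poly"
  assumes "k \<le> n"
  shows "q ^ (n - k) dvd (pderiv ^^ k) (q ^ n)"
  using assms
proof (induction k)
  case 0
  then show ?case by simp
next
  case (Suc k)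
  then have "q ^ (n - k) dvd (pderiv ^^ k) (q ^ n)" "n - k = Suc (n - Suc k)" by simp_all
  then obtain r where r: "(pderiv ^^ k) (q ^ n) = q ^ Suc (n - Suc k) * r"
    by (metis dvdE)
  show ?case
    by (simp add: r pderiv_mult pderiv_power_Suc del: power_Suc) (intro dvd_add dvd_smult; simp)
qed

text \<open>As long as \<open>k < n\<close>, the points -1 and 1 are roots of the
  \<open>k\<close>-th derivative. Together with the \<open>k\<close> interior roots they form
  \<open>k + 2\<close> points, whose \<open>k + 1\<close> gaps supply the roots of the next
  derivative.\<close>

lemma higher_pderiv_roots:
  assumes "k \<le> n"
  shows "\<exists>B. finite B \<and> card B = k \<and> B \<subseteq> {-1<..<1} \<and>
    (\<forall>x\<in>B. poly ((pderiv ^^ k) ([:-1, 0, 1:] ^ n)) x = (0::real))"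
  using assms
proof (induction k)
  case 0
  then show ?case by (intro exI[of _ "{}"]) simp
next
  case (Suc k)
  then obtain B where B: "finite B" "card B = k" "B \<subseteq> {-1<..<1}"
    "\<forall>x\<in>B. poly ((pderiv ^^ k) ([:-1, 0, 1:] ^ n)) x = (0::real)"
    by auto
  let ?p = "(pderiv ^^ k) ([:-1, 0, 1:] ^ n) :: real poly"
  have "[:-1, 0, 1:] ^ (n - k) dvd ?p" using Suc.prems by (intro higher_pderiv_power_dvd) simp
  then obtain r where "?p = [:-1, 0, 1:] ^ (n - k) * r" by blast
  then have "poly ?p 1 = 0" "poly ?p (-1) = 0"
    using Suc.prems by (auto simp: poly_power)
  let ?A = "insert (-1) (insert 1 B)"
  have "finite ?A" "?A \<noteq> {}" "\<forall>x\<in>?A. poly ?p x = 0"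
    using B \<open>poly ?p 1 = 0\<close> \<open>poly ?p (-1) = 0\<close> by blast+
  from pderiv_roots_between[OF this] obtain C where C: "finite C" "Suc (card C) = card ?A"
    "\<forall>x\<in>C. poly (pderiv ?p) x = 0 \<and> Min ?A < x \<and> x < Max ?A"
    by blast
  have "Min ?A = -1" by (rule Min_eqI) (use B in auto)
  moreover have "Max ?A = 1" by (rule Max_eqI) (use B in auto)
  moreover have "1 \<notin> B" "-1 \<notin> B" using B by auto
  then have "card ?A = k + 2" using B by simp
  ultimately show ?case using C by (intro exI[of _ C]) auto
qed

text \<open>The \<open>n\<close> interior roots from Rolle's theorem already exhaust the degree, so
  there are no others.\<close>

lemma legendre_roots:
  assumes "n > 0"
  shows "{x. poly (legendre n) x = 0} \<subseteq> {-1<..<1}" and "card {x. poly (legendre n) x = 0} = n"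
proof -
  let ?p = "(pderiv ^^ n) ([:-1, 0, 1:] ^ n) :: real poly"
  let ?R = "{x. poly ?p x = 0}"
  have deg: "degree ?p = n"
    by (simp add: degree_higher_pderiv degree_power_eq)
  then have "?p \<noteq> 0" using assms by force
  then have R: "finite ?R" "card ?R \<le> n"
    using poly_roots_finite card_poly_roots_bound deg by metis+
  obtain B where B: "card B = n" "B \<subseteq> {-1<..<1}" "B \<subseteq> ?R"
    using higher_pderiv_roots[of n n] by blast
  then have "B = ?R" using R by (intro card_seteq) auto
  moreover have "{x. poly (legendre n) x = 0} = ?R" by (simp add: legendre_def)
  ultimately show "{x. poly (legendre n) x = 0} \<subseteq> {-1<..<1}"
    "card {x. poly (legendre n) x = 0} = n" using B by simp_all
qed

text \<open>Since there are exactly \<open>n\<close> roots, the index \<open>j\<close> is in range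
  for the sorted list, and \<open>legendre_root\<close> is a genuine root.\<close>

lemma legendre_root_bounds:
  assumes "j < n"
  shows "legendre_root n j \<in> {-1<..<1}"
proof -
  let ?R = "{x. poly (legendre n) x = 0}"
  have n: "n > 0" using assms by simp
  then have fin: "finite ?R" using legendre_roots(2)[OF n] by (simp add: card_ge_0_finite)
  have "j < length (rev (sorted_list_of_set ?R))"
    using assms legendre_roots(2)[OF n] by simp
  then have "legendre_root n j \<in> set (rev (sorted_list_of_set ?R))"
    unfolding legendre_root_def by (rule nth_mem)
  then show ?thesis using legendre_roots(1)[OF n] fin by auto
qed

section \<open>Removable singularities\<close>

text \<open>Existence of a limit is not at issue: \<open>F\<close> has the same limits at both
  points, so the two \<open>Lim\<close> terms agree in any case.\<close>

lemma remove_sings_periodic: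
  assumes S: "\<And>x. x + c \<in> S \<longleftrightarrow> x \<in> S" and F: "\<And>x. F (x + c) = F x"
  shows "remove_sings S F (x + c) = remove_sings S F x"
proof -
  have "(F \<longlongrightarrow> l) (at (x + c)) \<longleftrightarrow> (F \<longlongrightarrow> l) (at x)" for l
  proof -
    have "(F \<longlongrightarrow> l) (at (x + c)) \<longleftrightarrow> (F \<longlongrightarrow> l) (filtermap (\<lambda>y. y - (- c)) (at x))"
      by (subst filtermap_at_shift) simp
    also have "\<dots> \<longleftrightarrow> (F \<longlongrightarrow> l) (at x)"
      by (simp add: filterlim_filtermap F)
    finally show ?thesis .
  qed
  then show ?thesis by (simp add: remove_sings_def S F Topological_Spaces.Lim_def)
qed

lemma remove_sings_eq_lim:
  assumes "x \<in> S" "(F \<longlongrightarrow> l) (at x)"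
  shows "remove_sings S F x = l"
  using assms by (simp add: remove_sings_def tendsto_Lim)

text \<open>Where \<open>F\<close> is continuous its limit is its value, so it does not matter
  whether the point belongs to \<open>S\<close>.\<close>

lemma remove_sings_isCont:
  assumes "isCont F x"
  shows "remove_sings S F x = F x"
  using assms by (simp add: remove_sings_def isCont_def tendsto_Lim)

text \<open>Zeros of the sine are isolated. If \<open>x0\<close> is a zero, the function equals
  \<open>sin (x - x0)\<close> up to the nonzero factor \<open>cos (x0 - a)\<close>, which leaves no
  other zero within distance \<open>pi\<close>.\<close>

lemma eventually_sin_nonzero:
  "eventually (\<lambda>x. sin (x - a) \<noteq> 0) (at (x0::real))"
proof (cases "sin (x0 - a) = 0")
  case False
  have "((\<lambda>x. sin (x - a)) \<longlongrightarrow> sin (x0 - a)) (at x0)" by (intro tendsto_intros)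
  then show ?thesis using False by (rule tendsto_imp_eventually_ne)
next
  case True
  have ne: "sin (x - x0) \<noteq> 0" if "x \<noteq> x0" "dist x x0 < pi" for x
  proof (cases "x > x0")
    case True
    then show ?thesis using that sin_gt_zero[of "x - x0"] by (auto simp: dist_real_def)
  next
    case False
    then show ?thesis using that sin_gt_zero[of "x0 - x"] sin_minus[of "x0 - x"]
      by (auto simp: dist_real_def)
  qed
  have "cos (x0 - a) \<noteq> 0" using True sin_cos_squared_add[of "x0 - a"] by auto
  have "sin (x - a) = sin (x - x0) * cos (x0 - a)" for x
    using sin_add[of "x - x0" "x0 - a"] True by simp
  then show ?thesis using ne \<open>cos (x0 - a) \<noteq> 0\<close>
    unfolding eventually_at by (intro exI[of _ pi]) auto
qed

lemma eventually_not_phi_sings: "eventually (\<lambda>x. x \<notin> phi_sings G m) (at x0)"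
proof -
  have "eventually (\<lambda>x. \<forall>k\<in>{..<m}. sin (x - grid_phi G m k) \<noteq> 0) (at x0)"
    by (intro eventually_ball_finite) (auto intro: eventually_sin_nonzero)
  then show ?thesis by eventually_elim (auto simp: phi_sings_def)
qed

section \<open>Symmetries of the interpolant\<close>

lemma csc_periodic_2pi: "csc (x + 2 * pi) = csc x"
  by (simp add: csc_def)

lemma cot_plus_pi: "cot (x + pi) = cot (x::real)"
  by (simp add: cot_def)

lemma csc_plus_pi: "csc (x + pi) = - csc x"
  by (simp add: csc_def)

lemma sph_interpolant_periodic:
  "sph_interpolant G m n d (\<phi> + 2 * pi) \<theta> = sph_interpolant G m n d \<phi> \<theta>"
proof -
  have shift: "x + 2 * pi - c = (x - c) + 2 * pi" for x c :: real by simp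
  show ?thesis unfolding sph_interpolant_def
    by (rule remove_sings_periodic)
      (simp_all only: phi_sings_def mem_Collect_eq shift sin_periodic cot_periodic csc_periodic_2pi)
qed

text \<open>Without u^s only cot over cot or csc over csc remains. The cotangent has period
  \<open>pi\<close>, and the sign change of the cosecant cancels in the quotient.\<close>

lemma sph_interpolant_half_turn:
  assumes "\<And>k. k < m \<Longrightarrow> us G m n d k \<theta> = 0"
  shows "sph_interpolant G m n d (\<phi> + pi) \<theta> = sph_interpolant G m n d \<phi> \<theta>"
proof -
  have shift: "x + pi - c = (x - c) + pi" for x c :: real by simp
  show ?thesis unfolding sph_interpolant_def
  proof (rule remove_sings_periodic, goal_cases)
    case 1
    show ?case by (simp add: phi_sings_def shift)
  next
    case 2
    show ?case
      by (simp add: Let_def shift cot_plus_pi csc_plus_pi assms sum_negf cong: sum.cong_simp)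
  qed
qed

section \<open>Values at the poles\<close>

lemma us_zero_regular:
  assumes "0 \<notin> theta_sings G n"
  shows "us G m n d k 0 = 0"
  using assms by (simp add: us_def remove_sings_def)

lemma SEQ_not_pole: "0 \<notin> theta_sings SEQ n"
proof -
  have "cos (pi / real n * (real j + 1 / 2)) \<noteq> 1" if "j < n" for j
  proof -
    have "pi / real n * (real j + 1 / 2) < pi" "0 < pi / real n * (real j + 1 / 2)"
      using that by (auto simp: pos_divide_less_eq intro!: mult_pos_pos divide_pos_pos)
    then show ?thesis using cos_monotone_0_pi[of 0 "pi / real n * (real j + 1 / 2)"] by simp
  qed
  then show ?thesis by (auto simp: theta_sings_def)
qed

lemma GL_not_pole: "0 \<notin> theta_sings GL n"
  using legendre_root_bounds[of _ n] by (force simp: theta_sings_def)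

lemma cos_EQ_between:
  assumes "0 < j" "j < n - 1"
  shows "cos (grid_theta EQ n j) \<in> {-1<..<1}"
proof -
  have "0 < grid_theta EQ n j" "grid_theta EQ n j < pi"
    using assms by (auto simp: pos_divide_less_eq intro!: mult_pos_pos divide_pos_pos)
  then show ?thesis
    using cos_monotone_0_pi[of 0 "grid_theta EQ n j"] cos_monotone_0_pi[of "grid_theta EQ n j" pi]
    by auto
qed

lemma grid_theta_EQ_last: "n > 1 \<Longrightarrow> grid_theta EQ n (n - 1) = pi"
  by (simp add: of_nat_diff)

section \<open>Alternating sums of cosines\<close>

text \<open>Multiplication by \<open>2 * cos (\<alpha> / 2)\<close> splits each summand into two
  cosines at half-integer multiples of \<alpha>; with the alternating signs these telescope.\<close>

lemma sum_alternating_cos: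
  assumes "cos (\<alpha> / 2) \<noteq> (0::real)"
  shows "(\<Sum>j<N. (-1) ^ j * cos (real j * \<alpha>))
    = (1 - (-1) ^ N * cos ((real N - 1 / 2) * \<alpha>) / cos (\<alpha> / 2)) / 2"
proof (induction N)
  case 0
  then show ?case using assms by simp
next
  case (Suc N)
  let ?c = "\<lambda>x. cos ((real N + x) * \<alpha>)"
  have "?c (1 / 2) + ?c (- 1 / 2) = 2 * cos (real N * \<alpha>) * cos (\<alpha> / 2)"
    using cos_add[of "real N * \<alpha>" "\<alpha> / 2"] cos_diff[of "real N * \<alpha>" "\<alpha> / 2"]
    by (simp add: algebra_simps)
  then have "cos (real N * \<alpha>) = (?c (1 / 2) + ?c (- 1 / 2)) / (2 * cos (\<alpha> / 2))"
    using assms by simp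
  then have "(\<Sum>j<Suc N. (-1) ^ j * cos (real j * \<alpha>))
      = (1 - (-1) ^ N * ?c (- 1 / 2) / cos (\<alpha> / 2)) / 2
        + (-1) ^ N * ((?c (1 / 2) + ?c (- 1 / 2)) / (2 * cos (\<alpha> / 2)))"
    by (simp add: Suc.IH)
  also have "\<dots> = (1 - (-1) ^ Suc N * ?c (1 / 2) / cos (\<alpha> / 2)) / 2"
    by (simp add: distrib_left add_divide_distrib diff_divide_distrib)
  also have "real N + 1 / 2 = real (Suc N) - 1 / 2" by simp
  finally show ?case .
qed

lemma sum_alternating: "(\<Sum>j<N. (-1) ^ j) = (1 - (-1) ^ N) / (2::real)"
  by (induction N) (auto simp: field_simps)


section \<open>Barycentric sums near a node or a pole\<close>

text \<open>A term of weight zero vanishes identically, even at its own node, because division by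
  zero yields 0. Only the nodes of nonzero weight must be avoided.\<close>

lemma bary_sum_isCont:
  assumes "\<And>j. j < n \<Longrightarrow> w j = 0 \<or> cos (grid_theta G n j) \<noteq> cos \<theta>0"
  shows "isCont (bary_sum G n w v) \<theta>0"
  unfolding bary_sum_def
proof (rule continuous_sum)
  fix j assume "j \<in> {..<n}"
  then have "w j = 0 \<or> cos (grid_theta G n j) \<noteq> cos \<theta>0" using assms by simp
  then show "isCont (\<lambda>\<theta>. complex_of_real (w j / (cos \<theta> - cos (grid_theta G n j))) * v j) \<theta>0"
    by (elim disjE) (auto intro!: continuous_intros)
qed

text \<open>The singular terms have weight zero and the denominator is nonzero, so the formula is
  continuous at \<theta>0. Its limit there is its value, and the factor \<open>sin \<theta>0\<close>
  makes that value zero.\<close>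

lemma us_zero_pole:
  assumes "sin \<theta>0 = 0"
    and "\<And>j. j < n \<Longrightarrow> us_num_weight G n j = 0 \<or> cos (grid_theta G n j) \<noteq> cos \<theta>0"
    and "\<And>j. j < n \<Longrightarrow> us_den_weight G n j = 0 \<or> cos (grid_theta G n j) \<noteq> cos \<theta>0"
    and "bary_sum G n (us_den_weight G n) (\<lambda>_. 1) \<theta>0 \<noteq> 0"
  shows "us G m n d k \<theta>0 = 0"
proof -
  have "isCont (\<lambda>\<theta>. complex_of_real (sin \<theta>)
          * (bary_sum G n (us_num_weight G n) (\<lambda>j. data_minus m d j k) \<theta>
             / bary_sum G n (us_den_weight G n) (\<lambda>_. 1) \<theta>)) \<theta>0"
    using assms by (intro continuous_intros bary_sum_isCont)
  from remove_sings_isCont[OF this] show ?thesis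
    unfolding us_def using assms(1) by simp
qed

text \<open>The factor \<open>cos \<theta> - cos \<theta>0\<close> cancels the singularity of the
  \<open>i\<close>-th term, leaving the constant \<open>w i * v i\<close>, and sends all other terms
  to zero.\<close>

lemma bary_sum_residue:
  assumes "i < n" "cos (grid_theta G n i) = cos \<theta>0"
    and "\<And>j. j < n \<Longrightarrow> j \<noteq> i \<Longrightarrow> cos (grid_theta G n j) \<noteq> cos \<theta>0"
    and ev: "eventually (\<lambda>\<theta>. cos \<theta> \<noteq> cos \<theta>0) (at \<theta>0)"
  shows "((\<lambda>\<theta>. complex_of_real (cos \<theta> - cos \<theta>0) * bary_sum G n w v \<theta>)
    \<longlongrightarrow> complex_of_real (w i) * v i) (at \<theta>0)"
proof (rule Lim_transform_eventually)
  let ?t = "\<lambda>\<theta> j. complex_of_real (w j / (cos \<theta> - cos (grid_theta G n j))) * v j"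
  let ?c = "\<lambda>\<theta>. complex_of_real (cos \<theta> - cos \<theta>0)"
  have "((\<lambda>\<theta>. complex_of_real (w i) * v i + ?c \<theta> * (\<Sum>j\<in>{..<n} - {i}. ?t \<theta> j))
    \<longlongrightarrow> complex_of_real (w i) * v i
      + complex_of_real (cos \<theta>0 - cos \<theta>0) * (\<Sum>j\<in>{..<n} - {i}. ?t \<theta>0 j)) (at \<theta>0)"
    by (intro tendsto_intros) (use assms(3) in force)
  then show "((\<lambda>\<theta>. complex_of_real (w i) * v i + ?c \<theta> * (\<Sum>j\<in>{..<n} - {i}. ?t \<theta> j))
    \<longlongrightarrow> complex_of_real (w i) * v i) (at \<theta>0)"
    by simp
  show "eventually (\<lambda>\<theta>. complex_of_real (w i) * v i + ?c \<theta> * (\<Sum>j\<in>{..<n} - {i}. ?t \<theta> j)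
    = ?c \<theta> * bary_sum G n w v \<theta>) (at \<theta>0)"
    using ev
  proof eventually_elim
    case (elim \<theta>)
    have "bary_sum G n w v \<theta> = ?t \<theta> i + (\<Sum>j\<in>{..<n} - {i}. ?t \<theta> j)"
      unfolding bary_sum_def using assms(1) by (intro sum.remove) auto
    moreover have "?c \<theta> * ?t \<theta> i = complex_of_real (w i) * v i"
      using elim assms(2) by (simp flip: of_real_diff)
    ultimately show ?case by (simp add: distrib_left)
  qed
qed

text \<open>The interpolation property of the barycentric formula: after scaling numerator and
  denominator by \<open>cos \<theta> - cos \<theta>0\<close>, both have limits, whose common factor
  \<open>uc_weight G n i\<close> cancels.\<close>

lemma uc_node:
  assumes "i < n" "cos (grid_theta G n i) = cos \<theta>0"
    and "\<And>j. j < n \<Longrightarrow> j \<noteq> i \<Longrightarrow> cos (grid_theta G n j) \<noteq> cos \<theta>0"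
    and "uc_weight G n i \<noteq> 0" "sin \<theta>0 = 0"
  shows "uc G m n d k \<theta>0 = data_plus m d i k"
  unfolding uc_def
proof (rule remove_sings_eq_lim)
  show "\<theta>0 \<in> theta_sings G n" using assms(1,2) by (auto simp: theta_sings_def)
  \<comment> \<open>At a pole, equal cosines force \<open>sin \<theta>\<close> = 0, and such points
    are isolated.\<close>
  have ev: "eventually (\<lambda>\<theta>. cos \<theta> \<noteq> cos \<theta>0) (at \<theta>0)"
    using eventually_sin_nonzero[of 0 \<theta>0]
  proof eventually_elim
    case (elim \<theta>)
    show ?case
    proof
      assume "cos \<theta> = cos \<theta>0"
      then have "(sin \<theta>)\<^sup>2 = (sin \<theta>0)\<^sup>2" by (simp add: sin_squared_eq)
      then show False using elim assms(5) by simp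
    qed
  qed
  let ?c = "\<lambda>\<theta>. complex_of_real (cos \<theta> - cos \<theta>0)"
  let ?num = "bary_sum G n (uc_weight G n) (\<lambda>j. data_plus m d j k)"
  let ?den = "bary_sum G n (uc_weight G n) (\<lambda>_. 1)"
  show "((\<lambda>\<theta>. ?num \<theta> / ?den \<theta>) \<longlongrightarrow> data_plus m d i k) (at \<theta>0)"
  proof (rule Lim_transform_eventually)
    have "((\<lambda>\<theta>. (?c \<theta> * ?num \<theta>) / (?c \<theta> * ?den \<theta>))
      \<longlongrightarrow> complex_of_real (uc_weight G n i) * data_plus m d i k
        / (complex_of_real (uc_weight G n i) * 1)) (at \<theta>0)"
      using assms ev by (intro tendsto_divide bary_sum_residue) auto
    then show "((\<lambda>\<theta>. (?c \<theta> * ?num \<theta>) / (?c \<theta> * ?den \<theta>)) \<longlongrightarrow> data_plus m d i k) (at \<theta>0)"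
      using assms(4) by simp
    show "eventually (\<lambda>\<theta>. (?c \<theta> * ?num \<theta>) / (?c \<theta> * ?den \<theta>) = ?num \<theta> / ?den \<theta>) (at \<theta>0)"
      using ev by eventually_elim (simp flip: of_real_diff)
  qed
qed

section \<open>Pole values on the EQ grid\<close>

text \<open>Up to sign and the term at the pole itself, these are the denominators of u^s at the two
  poles once sin^2 = (1 - cos) (1 + cos) has been cancelled.\<close>

lemma EQ_alternating_sums:
  assumes "n \<ge> 3"
  shows "(\<Sum>j<n. (-1) ^ j * (1 + cos (grid_theta EQ n j))) = 1"
    and "(\<Sum>j<n. (-1) ^ j * (1 - cos (grid_theta EQ n j))) = - ((-1) ^ n)"
proof -
  let ?\<alpha> = "pi / (real n - 1)"
  have "?\<alpha> / 2 < pi / 2" "0 \<le> ?\<alpha>" using assms by (auto simp: field_simps)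
  have "- (pi / 2) < 0" by simp
  also have "0 \<le> ?\<alpha> / 2" using \<open>0 \<le> ?\<alpha>\<close> by (rule divide_nonneg_nonneg) simp
  finally have ne: "cos (?\<alpha> / 2) \<noteq> 0"
    using cos_gt_zero_pi \<open>?\<alpha> / 2 < pi / 2\<close> by force
  \<comment> \<open>The angle in the closed form exceeds half a step by exactly \<open>pi\<close>,
    so the quotient of cosines there is -1.\<close>
  have "(real n - 1 / 2) * ?\<alpha> = pi + ?\<alpha> / 2" using assms by (simp add: field_simps)
  then have "cos ((real n - 1 / 2) * ?\<alpha>) = - cos (?\<alpha> / 2)"
    by (simp add: cos_add)
  then have "(\<Sum>j<n. (-1) ^ j * cos (grid_theta EQ n j)) = (1 + (-1) ^ n) / 2"
    using sum_alternating_cos[OF ne, of n] ne by (simp add: mult.commute)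
  then show "(\<Sum>j<n. (-1) ^ j * (1 + cos (grid_theta EQ n j))) = 1"
    "(\<Sum>j<n. (-1) ^ j * (1 - cos (grid_theta EQ n j))) = - ((-1) ^ n)"
    by (simp_all add: distrib_left right_diff_distrib sum.distrib sum_subtractf sum_alternating
        field_simps del: grid_theta.simps)
qed

lemma EQ_index_cases:
  assumes "j < n" "n \<ge> 3"
  obtains "j = 0" "grid_theta EQ n j = 0"
  | "0 < j" "j = n - 1" "grid_theta EQ n j = pi"
  | "0 < j" "j < n - 1" "cos (grid_theta EQ n j) \<noteq> 1" "cos (grid_theta EQ n j) \<noteq> -1"
proof -
  consider "j = 0" | "0 < j" "j = n - 1" | "0 < j" "j < n - 1" using assms by linarith
  then show thesis
  proof cases
    case 1
    then show ?thesis using that(1) by simp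
  next
    case 2
    then show ?thesis using that(2) grid_theta_EQ_last[of n] assms by simp
  next
    case 3
    then show ?thesis using that(3) cos_EQ_between[of j n] by auto
  qed
qed

text \<open>Away from \<open>j = 0\<close> the quotient sin^2 / (1 - cos) is 1 + cos. At
  \<open>j = 0\<close> the term is 0, while 1 + cos is 2; this is the subtracted 2, and the value is
  1 - 2.\<close>

lemma EQ_us_den_0:
  assumes "n \<ge> 3"
  shows "bary_sum EQ n (us_den_weight EQ n) (\<lambda>_. 1) 0 = -1"
proof -
  have "us_den_weight EQ n j / (cos 0 - cos (grid_theta EQ n j))
      = (-1) ^ j * (1 + cos (grid_theta EQ n j)) - (if j = 0 then 2 else 0)" if "j < n" for j
    using that assms
  proof (cases rule: EQ_index_cases)
    case 3
    then have "1 - cos (grid_theta EQ n j) \<noteq> 0" by linarith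
    with 3 show ?thesis
      by (simp del: grid_theta.simps add: sin_squared_eq divide_simps)
        (simp add: algebra_simps power2_eq_square)
  qed (use assms in \<open>auto simp del: grid_theta.simps\<close>)
  then have "(\<Sum>j<n. us_den_weight EQ n j / (cos 0 - cos (grid_theta EQ n j)))
      = (\<Sum>j<n. (-1) ^ j * (1 + cos (grid_theta EQ n j)) - (if j = 0 then 2 else 0))"
    by (intro sum.cong) auto
  also have "\<dots> = -1"
    using assms by (simp only: sum_subtractf EQ_alternating_sums) (simp add: sum.delta)
  finally show ?thesis
    by (simp only: bary_sum_def mult_1_right flip: of_real_sum) simp
qed

text \<open>Mirror image of the north pole: sin^2 / (-1 - cos) is -(1 - cos), and the correction
  sits at \<open>j = n - 1\<close>.\<close>

lemma EQ_us_den_pi: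
  assumes "n \<ge> 3"
  shows "bary_sum EQ n (us_den_weight EQ n) (\<lambda>_. 1) pi = - ((-1) ^ n)"
proof -
  have "us_den_weight EQ n j / (cos pi - cos (grid_theta EQ n j))
      = (if j = n - 1 then 2 * (-1) ^ j else 0) - (-1) ^ j * (1 - cos (grid_theta EQ n j))"
    if "j < n" for j
    using that assms
  proof (cases rule: EQ_index_cases)
    case 3
    then have "-1 - cos (grid_theta EQ n j) \<noteq> 0" by linarith
    with 3 show ?thesis
      by (simp del: grid_theta.simps add: sin_squared_eq divide_simps)
        (simp add: algebra_simps power2_eq_square)
  qed (use assms in \<open>auto simp del: grid_theta.simps\<close>)
  then have "(\<Sum>j<n. us_den_weight EQ n j / (cos pi - cos (grid_theta EQ n j)))
      = (\<Sum>j<n. (if j = n - 1 then 2 * (-1) ^ j else 0) - (-1) ^ j * (1 - cos (grid_theta EQ n j)))"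
    by (intro sum.cong) auto
  also have "\<dots> = 2 * (-1) ^ (n - 1) + (-1) ^ n"
    using assms by (simp only: sum_subtractf EQ_alternating_sums) (simp add: sum.delta)
  also have "\<dots> = - ((-1) ^ n)"
    using assms by (cases n) auto
  finally show ?thesis
    by (simp only: bary_sum_def mult_1_right flip: of_real_sum) simp
qed

lemma us_EQ_poles:
  assumes "n \<ge> 3" "\<theta>0 = 0 \<or> \<theta>0 = pi"
  shows "us EQ m n d k \<theta>0 = 0"
proof (rule us_zero_pole)
  show "sin \<theta>0 = 0" using assms by auto
  \<comment> \<open>A node that shares its cosine with a pole is that pole. Its sine is zero, and
    the sine is a factor of both weights.\<close>
  have "sin (grid_theta EQ n j) = 0 \<or> cos (grid_theta EQ n j) \<noteq> cos \<theta>0" if "j < n" for j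
    using that assms(1) by (cases rule: EQ_index_cases) (use assms in auto)
  then show "us_num_weight EQ n j = 0 \<or> cos (grid_theta EQ n j) \<noteq> cos \<theta>0"
    "us_den_weight EQ n j = 0 \<or> cos (grid_theta EQ n j) \<noteq> cos \<theta>0" if "j < n" for j
    using that by auto
  show "bary_sum EQ n (us_den_weight EQ n) (\<lambda>_. 1) \<theta>0 \<noteq> 0"
    using assms EQ_us_den_0 EQ_us_den_pi by auto
qed

lemma uc_EQ_north:
  assumes "n \<ge> 3"
  shows "uc EQ m n d k 0 = data_plus m d 0 k"
proof (rule uc_node)
  fix j assume "j < n" and j: "j \<noteq> 0"
  then show "cos (grid_theta EQ n j) \<noteq> cos 0"
    using assms
    by (cases rule: EQ_index_cases[OF \<open>j < n\<close> assms]) (use j in auto)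
qed (use assms in auto)

lemma uc_EQ_south:
  assumes "n \<ge> 3"
  shows "uc EQ m n d k pi = data_plus m d (n - 1) k"
proof (rule uc_node)
  show "cos (grid_theta EQ n (n - 1)) = cos pi"
    using grid_theta_EQ_last[of n] assms by simp
  fix j assume "j < n" and j: "j \<noteq> n - 1"
  then show "cos (grid_theta EQ n j) \<noteq> cos pi"
    using assms
    by (cases rule: EQ_index_cases[OF \<open>j < n\<close> assms]) (use j in auto)
qed (use assms in auto)

section \<open>The longitudinal denominators\<close>

text \<open>The Dirichlet kernel of order \<open>q\<close> at \<open>2 * x\<close>, with the
  denominator \<open>sin x\<close> cleared. The products \<open>2 * sin x * cos (2 * l * x)\<close>
  telescope.\<close>

lemma dirichlet_kernel:
  "sin x * (1 + 2 * (\<Sum>l<q. cos (2 * real (Suc l) * x))) = sin ((2 * real q + 1) * (x::real))"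
proof (induction q)
  case 0
  then show ?case by simp
next
  case (Suc q)
  have "sin (2 * real (Suc q) * x + x) - sin (2 * real (Suc q) * x - x)
      = 2 * sin x * cos (2 * real (Suc q) * x)"
    by (simp only: sin_add sin_diff) simp
  moreover have "2 * real (Suc q) * x - x = (2 * real q + 1) * x"
    "2 * real (Suc q) * x + x = (2 * real (Suc q) + 1) * x"
    by (simp_all add: algebra_simps)
  ultimately show ?case using Suc.IH
    by (simp add: algebra_simps del: of_nat_Suc)
qed

text \<open>Multiplication by \<open>2 * sin \<beta>\<close> turns the sum into a telescoping one in
  \<open>T\<close>. The bounds on \<open>p\<close> give \<open>sin \<beta> \<noteq> 0\<close>, and
  over \<open>m\<close> steps the argument of \<open>T\<close> moves by the full period
  \<open>2 * pi * p\<close>, so the ends cancel.\<close>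

lemma sum_cos_equispaced:
  assumes "0 < p" "p < m"
  shows "(\<Sum>k<m. cos (2 * real p * (\<phi> - pi / real m * real k))) = 0"
proof -
  define \<beta> where "\<beta> = pi * real p / real m"
  define T where "T = (\<lambda>k. sin (2 * real p * \<phi> - 2 * \<beta> * real k + \<beta>))"
  have "0 < \<beta>" "\<beta> < pi" using assms by (auto simp: \<beta>_def field_simps)
  then have \<beta>: "sin \<beta> \<noteq> 0" using sin_gt_zero by force
  have "2 * sin \<beta> * cos (2 * real p * (\<phi> - pi / real m * real k)) = T k - T (Suc k)" for k
  proof -
    have "2 * real p * (\<phi> - pi / real m * real k) = 2 * real p * \<phi> - 2 * \<beta> * real k"
      using assms by (simp add: \<beta>_def field_simps)
    moreover have "T (Suc k) = sin (2 * real p * \<phi> - 2 * \<beta> * real k - \<beta>)"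
      by (simp add: T_def algebra_simps)
    ultimately show ?thesis by (simp add: T_def sin_add sin_diff[of _ \<beta>])
  qed
  then have "2 * sin \<beta> * (\<Sum>k<m. cos (2 * real p * (\<phi> - pi / real m * real k)))
      = (\<Sum>k<m. T k - T (Suc k))"
    by (simp add: sum_distrib_left)
  also have "\<dots> = T 0 - T m" by (rule sum_lessThan_telescope')
  also have "T m = T 0"
  proof -
    have "2 * \<beta> * real m = 2 * pi * real p" using assms by (simp add: \<beta>_def)
    then have "2 * real p * \<phi> - 2 * \<beta> * real m + \<beta> = 2 * real p * \<phi> + \<beta> - 2 * pi * real p"
      by linarith
    then have "T m = sin (2 * real p * \<phi> + \<beta> - 2 * pi * real p)" by (simp only: T_def)
    also have "\<dots> = T 0"
      using sin_2npi[of p] cos_2npi[of p] by (simp only: sin_diff) (simp add: T_def mult_ac)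
    finally show ?thesis .
  qed
  finally show ?thesis using \<beta> by simp
qed

text \<open>The frequencies \<open>Suc l\<close> lie between 1 and \<open>q < m\<close>, so each
  cosine sums to zero and only the constant 1 survives.\<close>

lemma sum_dirichlet_kernel:
  assumes "q < m"
  shows "(\<Sum>k<m. 1 + 2 * (\<Sum>l<q. cos (2 * real (Suc l) * (\<phi> - pi / real m * real k)))) = real m"
proof -
  have "(\<Sum>k<m. \<Sum>l<q. cos (2 * real (Suc l) * (\<phi> - pi / real m * real k))) = 0"
    using assms by (subst sum.swap) (intro sum.neutral ballI sum_cos_equispaced; simp)
  then show ?thesis by (simp add: sum.distrib flip: sum_distrib_left)
qed

lemma sin_mult_shift:
  assumes "m > 0"
  shows "sin (real m * (\<phi> - pi / real m * real k)) = (-1) ^ k * sin (real m * \<phi>)"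
proof -
  have "real m * (\<phi> - pi / real m * real k) = real m * \<phi> - real k * pi"
    using assms by (simp add: field_simps)
  then show ?thesis by (simp add: sin_diff)
qed

text \<open>Both denominators are \<open>m / sin (m\<phi>)\<close>: multiplication by \<open>sin (m\<phi>)\<close> turns the summands
  into Dirichlet kernels, and summing those over equispaced points leaves only the constant term.\<close>

lemma csc_denominator:
  assumes "odd m" "\<And>k. k < m \<Longrightarrow> sin (\<phi> - pi / real m * real k) \<noteq> 0"
  shows "sin (real m * \<phi>) * (\<Sum>k<m. (-1) ^ k * csc (\<phi> - pi / real m * real k)) = real m"
proof -
  obtain q where q: "m = 2 * q + 1" using assms(1) by (auto elim: oddE)
  have "sin (real m * \<phi>) * (\<Sum>k<m. (-1) ^ k * csc (\<phi> - pi / real m * real k))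
    = (\<Sum>k<m. 1 + 2 * (\<Sum>l<q. cos (2 * real (Suc l) * (\<phi> - pi / real m * real k))))"
    unfolding sum_distrib_left[of "sin (real m * \<phi>)"]
  proof (rule sum.cong[OF refl])
    fix k assume "k \<in> {..<m}"
    define x where "x = \<phi> - pi / real m * real k"
    have ne: "sin x \<noteq> 0" using assms(2) \<open>k \<in> {..<m}\<close> by (simp add: x_def)
    have "real m > 0" "real m = 2 * real q + 1" using q by simp_all
    then have "sin ((2 * real q + 1) * x) = (-1) ^ k * sin (real m * \<phi>)"
      using sin_mult_shift[of m \<phi> k] by (simp only: x_def of_nat_0_less_iff)
    then have "(1 + 2 * (\<Sum>l<q. cos (2 * real (Suc l) * x))) = (-1) ^ k * sin (real m * \<phi>) / sin x"
      unfolding dirichlet_kernel[symmetric] using ne by (metis nonzero_mult_div_cancel_left)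
    then show "sin (real m * \<phi>) * ((-1) ^ k * csc (\<phi> - pi / real m * real k))
      = 1 + 2 * (\<Sum>l<q. cos (2 * real (Suc l) * (\<phi> - pi / real m * real k)))"
      by (simp only: x_def[symmetric] csc_def) simp
  qed
  also have "\<dots> = real m" using q by (intro sum_dirichlet_kernel) simp
  finally show ?thesis .
qed

lemma cot_denominator:
  assumes "even m" "m > 0" "\<And>k. k < m \<Longrightarrow> sin (\<phi> - pi / real m * real k) \<noteq> 0"
  shows "sin (real m * \<phi>) * (\<Sum>k<m. (-1) ^ k * cot (\<phi> - pi / real m * real k)) = real m"
proof -
  obtain q where q: "m = 2 * Suc q" using assms(1,2) by (metis evenE gr0_conv_Suc mult_0_right not_gr0)
  let ?D = "\<lambda>q k. 1 + 2 * (\<Sum>l<q. cos (2 * real (Suc l) * (\<phi> - pi / real m * real k)))"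
  have "sin (real m * \<phi>) * (\<Sum>k<m. (-1) ^ k * cot (\<phi> - pi / real m * real k))
    = (\<Sum>k<m. (?D q k + ?D (Suc q) k) / 2)"
    unfolding sum_distrib_left[of "sin (real m * \<phi>)"]
  proof (rule sum.cong[OF refl])
    fix k assume "k \<in> {..<m}"
    define x where "x = \<phi> - pi / real m * real k"
    have ne: "sin x \<noteq> 0" using assms(3) \<open>k \<in> {..<m}\<close> by (simp add: x_def)
    \<comment> \<open>As \<open>m\<close> is \<open>2 * q + 2\<close>, these are the angles
      \<open>(m - 1) * x\<close> and \<open>(m + 1) * x\<close>. The sum of their sines is
      \<open>2 * sin (m * x) * cos x\<close>, so \<open>sin (m * x) * cot x\<close> is the mean of
      the kernels of orders \<open>q\<close> and \<open>Suc q\<close>.\<close>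
    have "(2 * real q + 1) * x = real m * x - x" "(2 * real (Suc q) + 1) * x = real m * x + x"
      using q by (simp_all add: algebra_simps)
    then have "sin ((2 * real q + 1) * x) + sin ((2 * real (Suc q) + 1) * x) = 2 * (sin (real m * x) * cos x)"
      by (simp only: sin_add sin_diff)
    then have "sin x * (?D q k + ?D (Suc q) k) = 2 * (sin (real m * x) * cos x)"
      unfolding dirichlet_kernel[symmetric] x_def by (simp only: distrib_left)
    moreover have "a / 2 = b / sin x" if "sin x * a = 2 * b" for a b
      using that ne by (simp add: field_simps)
    ultimately have "(?D q k + ?D (Suc q) k) / 2 = sin (real m * x) * cos x / sin x" by blast
    moreover have "sin (real m * x) = (-1) ^ k * sin (real m * \<phi>)"
      unfolding x_def using assms(2) by (rule sin_mult_shift)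
    ultimately show "sin (real m * \<phi>) * ((-1) ^ k * cot (\<phi> - pi / real m * real k))
      = (?D q k + ?D (Suc q) k) / 2"
      by (simp only: x_def[symmetric] cot_def) simp
  qed
  also have "\<dots> = ((\<Sum>k<m. ?D q k) + (\<Sum>k<m. ?D (Suc q) k)) / 2"
    by (subst sum_divide_distrib[symmetric], subst sum.distrib, rule refl)
  also have "(\<Sum>k<m. ?D q k) = real m" using q by (intro sum_dirichlet_kernel) simp
  also have "(\<Sum>k<m. ?D (Suc q) k) = real m" using q by (intro sum_dirichlet_kernel) simp
  also have "(real m + real m) / 2 = real m" by simp
  finally show ?thesis .
qed

text \<open>Off the singular set the numerator is \<open>c\<close> times the denominator, which is
  nonzero because its product with \<open>sin (m * \<phi>)\<close> is \<open>m\<close>.\<close>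

lemma sph_interpolant_EQ_const:
  assumes m: "m > 0" and us: "\<And>k. k < m \<Longrightarrow> us EQ m n d k \<theta> = 0"
    and uc: "\<And>k. k < m \<Longrightarrow> uc EQ m n d k \<theta> = c"
  shows "sph_interpolant EQ m n d \<phi> \<theta> = c"
proof -
  define F where "F = (\<lambda>\<phi>. let C = (\<lambda>k. complex_of_real (cot (\<phi> - grid_phi EQ m k)));
              D = (\<lambda>k. complex_of_real (csc (\<phi> - grid_phi EQ m k)))
          in if even m
             then (\<Sum>k<m. (- 1) ^ k * (C k * uc EQ m n d k \<theta> + D k * us EQ m n d k \<theta>))
                  / (\<Sum>k<m. (- 1) ^ k * C k)
             else (\<Sum>k<m. (- 1) ^ k * (D k * uc EQ m n d k \<theta> + C k * us EQ m n d k \<theta>))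
                  / (\<Sum>k<m. (- 1) ^ k * D k))"
  have F: "F x = c" if "x \<notin> phi_sings EQ m" for x
  proof -
    have ne: "sin (x - pi / real m * real k) \<noteq> 0" if "k < m" for k
      using that \<open>x \<notin> phi_sings EQ m\<close> by (auto simp: phi_sings_def)
    let ?C = "\<Sum>k<m. (-1) ^ k * cot (x - grid_phi EQ m k)"
    let ?D = "\<Sum>k<m. (-1) ^ k * csc (x - grid_phi EQ m k)"
    show ?thesis
    proof (cases "even m")
      case True
      have "?C \<noteq> 0" using cot_denominator[OF True m ne] m by auto
      then have "complex_of_real ?C \<noteq> 0" by (simp only: of_real_eq_0_iff not_False_eq_True)
      moreover have "F x = complex_of_real ?C * c / complex_of_real ?C"
        using True by (simp add: F_def us uc sum_distrib_right mult.assoc del: grid_phi.simps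
            cong: sum.cong_simp)
      ultimately show ?thesis by simp
    next
      case False
      have "?D \<noteq> 0" using csc_denominator[OF False ne] m by auto
      then have "complex_of_real ?D \<noteq> 0" by (simp only: of_real_eq_0_iff not_False_eq_True)
      moreover have "F x = complex_of_real ?D * c / complex_of_real ?D"
        using False by (simp add: F_def us uc sum_distrib_right mult.assoc del: grid_phi.simps
            cong: sum.cong_simp)
      ultimately show ?thesis by simp
    qed
  qed
  have s: "sph_interpolant EQ m n d \<phi> \<theta> = remove_sings (phi_sings EQ m) F \<phi>"
    by (simp only: sph_interpolant_def F_def)
  show ?thesis
  proof (cases "\<phi> \<in> phi_sings EQ m")
    case True
    \<comment> \<open>Singular points are isolated, so the limit at one of them is that of a
      function equal to \<open>c\<close> nearby.\<close>
    have "eventually (\<lambda>x. F x = c) (at \<phi>)"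
      using eventually_not_phi_sings by eventually_elim (rule F)
    then have "(F \<longlongrightarrow> c) (at \<phi>)" by (rule tendsto_eventually)
    then show ?thesis using True by (simp add: s remove_sings_eq_lim)
  next
    case False
    then show ?thesis by (simp add: s remove_sings_def F)
  qed
qed

section \<open>Samples at the poles and assembly of the result\<close>

lemma sph_point_poles:
  assumes "sin \<theta> = 0"
  shows "sph_point \<phi> \<theta> = sph_point 0 \<theta>"
  using assms by (simp add: sph_point_def)

lemma data_plus_pole:
  assumes "sin (grid_theta G n j) = 0"
  shows "data_plus m (samples G m n f) j k = f (sph_point 0 (grid_theta G n j))"
  by (simp add: data_plus_def samples_def sph_point_poles[OF assms, of "grid_phi G m _"])

theorem theorem1:
  fixes m n :: nat and G :: grid and f :: "real ^ 3 \<Rightarrow> complex"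
    and s :: "real \<Rightarrow> real \<Rightarrow> complex"
  assumes "m > 0" and "n > 0"
    and "G = EQ \<Longrightarrow> n \<ge> 3"
    and "continuous_on (sphere 0 1) f"
  defines "s \<equiv> sph_interpolant G m n (samples G m n f)"
  shows "(\<exists>F. is_dfs_extension s F) \<and>
    (\<forall>F. is_dfs_extension s F \<longrightarrow> is_BMC pi pi F \<and> (G = EQ \<longrightarrow> is_BMC_I pi pi F))"
proof -
  have period: "s (x + 2 * pi) y = s x y" for x y
    unfolding s_def by (rule sph_interpolant_periodic)
  have "us G m n (samples G m n f) k 0 = 0" for k
    using us_EQ_poles us_zero_regular SEQ_not_pole GL_not_pole assms(3) by (cases G) auto
  then have half: "s (x + pi) 0 = s x 0" for x
    unfolding s_def by (intro sph_interpolant_half_turn)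
  have ext: "\<exists>F. is_dfs_extension s F"
  proof
    \<comment> \<open>The blocks overlap along \<theta> = 0, where the half-turn symmetry at the
      pole makes them agree, and along \<phi> = \<open>pi\<close>, where for negative \<theta> the
      period \<open>2 * pi\<close> identifies \<open>s (2 * pi)\<close> with
      \<open>s 0\<close>.\<close>
    show "is_dfs_extension s (\<lambda>x y. if y \<ge> 0 then s x y else if x < pi then s (x + pi) (- y)
        else s (x - pi) (- y))"
      using half half[of 0] half[of "_ - pi"] period[of 0] by (auto simp: is_dfs_extension_def Let_def)
  qed
  have BMC: "is_BMC pi pi F \<and> (G = EQ \<longrightarrow> is_BMC_I pi pi F)" if "is_dfs_extension s F" for F
  proof -
    have F: "\<And>x y. x \<in> {0..pi} \<Longrightarrow> y \<in> {0..pi} \<Longrightarrow> F x y = s x y"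
      "\<And>x y. x \<in> {pi..2*pi} \<Longrightarrow> y \<in> {0..pi} \<Longrightarrow> F x y = s x y"
      "\<And>x y. x \<in> {pi..2*pi} \<Longrightarrow> y \<in> {-pi..0} \<Longrightarrow> F x y = s (x - pi) (- y)"
      "\<And>x y. x \<in> {0..pi} \<Longrightarrow> y \<in> {-pi..0} \<Longrightarrow> F x y = s (x + pi) (- y)"
      using that by (auto simp: is_dfs_extension_def Let_def)
    have BMC: "is_BMC pi pi F"
      unfolding is_BMC_def
    proof (intro conjI ballI)
      fix y :: real assume y: "y \<in> {-pi..pi}"
      \<comment> \<open>For \<open>y \<ge> 0\<close> this is the period of \<open>s\<close>; for
        negative \<open>y\<close> both sides are \<open>s pi (- y)\<close>.\<close>
      show "F 0 y = F (2 * pi) y"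
        using y period[of 0] by (cases "y \<ge> 0") (auto simp: F)
    qed (rule exI[of _ s], rule exI[of _ "\<lambda>x. s (x + pi)"], auto simp: F)
    moreover have "is_BMC_I pi pi F" if G: "G = EQ"
    proof -
      have n: "n \<ge> 3" using assms(3) G .
      have "\<exists>c. \<forall>x. s x y = c" if y: "y = 0 \<or> y = pi" for y
      proof -
        \<comment> \<open>The index of the node at the pole \<open>y\<close>.\<close>
        define j where "j = (if y = 0 then 0 else n - 1)"
        have "grid_theta EQ n j = y" using y n grid_theta_EQ_last[of n] by (auto simp: j_def)
        then have "sin (grid_theta EQ n j) = 0" using y by auto
        then have "data_plus m (samples EQ m n f) j k = f (sph_point 0 (grid_theta EQ n j))" for k
          by (rule data_plus_pole)
        moreover have "uc EQ m n d k y = data_plus m d j k" for d k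
          using y n uc_EQ_north uc_EQ_south by (auto simp: j_def)
        ultimately have "s x y = f (sph_point 0 (grid_theta EQ n j))" for x
          unfolding s_def G using assms(1) y n
          by (intro sph_interpolant_EQ_const us_EQ_poles) simp_all
        then show ?thesis by blast
      qed
      then obtain c0 c1 where c: "\<And>x. s x 0 = c0" "\<And>x. s x pi = c1" by metis
      \<comment> \<open>On the lower blocks \<open>F\<close> evaluates \<open>s\<close> at
        \<open>- y\<close>, so \<open>F x (- pi)\<close> is a value of \<open>s\<close> at the south
        pole, just as \<open>F x pi\<close> is.\<close>
      have "F x 0 = c0 \<and> F x pi = c1 \<and> F x (- pi) = c1" if "x \<in> {0..2*pi}" for x
        using that by (cases "x \<le> pi") (auto simp: F c)
      then show ?thesis
        using BMC by (auto simp: is_BMC_I_def constant_on_def)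
    qed
    ultimately show ?thesis by blast
  qed
  show ?thesis using ext BMC by blast
qed

end
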